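(* Let $2\le k\le n-2$ and $r=n-k$. Then $$F_{k,n}(x):=\sum_{F\in\Delta_k(P_n^2)}x^{|F|}=\sum_{p=0}^{r}\binom{n}{p}x^p-rx^{r-1}-z_{k,n}x^r,$$ where $z_{k,n}=\sum_{j=0}^{\min\{k-1,r\}}\binom{k-1}{j}(r-j+1)$. Equivalently, the number of faces of $\Delta_k(P_n^2)$ of cardinality $p$ is $\binom{n}{p}$ for $0\le p\le r-2$, is $\binom{n}{r-1}-r$ for $p=r-1$, and is $\binom{n}{r}-z_{k,n}$ for $p=r$ (and there are no faces of cardinality greater than $r$).
   Context: For a finite simple graph $G$ on $[n]=\{1,\dots,n\}$ and $2\le k\le n$, the $k$-cut complex $\Delta_k(G)$ is the simplicial complex on $[n]$ whose facets are the sets $[n]\setminus T$, where $T$ ranges over the $k$-element subsets of $[n]$ with $G[T]$ disconnected. The squared path $P_n^2$ is the graph on $[n]$ whose edges are the pairs $\{i,i+1\}$ ($1\le i\le n-1$) and $\{i,i+2\}$ ($1\le i\le n-2$). The sum over faces includes the empty face. *)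

theory Defs
  imports
    "HOL-Computational_Algebra.Polynomial"
    "Graph_Theory.Graph_Theory"
begin

text \<open>
  Simple graphs are the finite symmetric loop-free digraphs of the locale \<^locale>\<open>pair_graph\<close>:
  an undirected edge \<open>{u, v}\<close> is the pair of arcs \<open>(u, v)\<close>, \<open>(v, u)\<close>.
\<close>

definition squared_path :: "nat \<Rightarrow> nat pair_pre_digraph" where
  "squared_path n =
    \<lparr> pverts = {1..n},
      parcs = (\<Union>i \<in> {i. 1 \<le> i \<and> i + 1 \<le> n}. {(i, i + 1), (i + 1, i)}) \<union>
              (\<Union>i \<in> {i. 1 \<le> i \<and> i + 2 \<le> n}. {(i, i + 2), (i + 2, i)}) \<rparr>"

lemma pair_graph_squared_path: "pair_graph (squared_path n)"
proof
  have "parcs (squared_path n) \<subseteq> {1..n} \<times> {1..n}"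
    by (auto simp: squared_path_def)
  then show "finite (parcs (squared_path n))"
    by (rule finite_subset) simp
  show "symmetric (with_proj (squared_path n))"
    by (auto simp: symmetric_def sym_def squared_path_def)
qed (auto simp: squared_path_def)

definition cut_complex_facets :: "nat \<Rightarrow> 'a pair_pre_digraph \<Rightarrow> 'a set set" where
  "cut_complex_facets k G =
    {pverts G - T | T. T \<subseteq> pverts G \<and> card T = k \<and> \<not> connected (with_proj G \<restriction> T)}"

text \<open>
  A complex is represented by its set of faces, the empty face included. If there is no
  disconnected \<open>k\<close>-set, the complex below has no faces at all.
\<close>

definition cut_complex :: "nat \<Rightarrow> 'a pair_pre_digraph \<Rightarrow> 'a set set" where
  "cut_complex k G = {F. \<exists>S \<in> cut_complex_facets k G. F \<subseteq> S}"

definition face_poly :: "'a set set \<Rightarrow> int poly" where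
  "face_poly \<Delta> = (\<Sum>F\<in>\<Delta>. monom 1 (card F))"

text \<open>
  Below, \<open>r\<close> stands for \<open>n - k\<close>. The natural number subtraction \<open>r - j\<close> is exact, because \<open>j \<le> r\<close>.
\<close>

definition z_coeff :: "nat \<Rightarrow> nat \<Rightarrow> nat" where
  "z_coeff k n = (let r = n - k in \<Sum>j = 0..min (k - 1) r. ((k - 1) choose j) * (r - j + 1))"

end

theory Submission
  imports Defs
begin

text \<open>
  A finite set \<open>T\<close> of naturals induces a connected subgraph of the squared path iff its consecutive
  elements differ by at most 2. Faces are counted through the complements of non-faces: these are
  the vertex sets all of whose \<open>k\<close>-subsets are connected. There are none of size at least \<open>k + 2\<close>,
  because dropping the second and third smallest elements leaves a gap of at least 3. Those of size
  \<open>k + 1\<close> are the \<open>r\<close> intervals, because a gap of 2 becomes a gap of at least 3 when one of its two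
  ends is dropped. Those of size \<open>k\<close> are the connected sets: with \<open>j\<close> gaps equal to 2 there are
  \<open>(k - 1) choose j\<close> gap patterns of span \<open>k + j\<close>, each in \<open>r - j + 1\<close> positions.
\<close>

section \<open>Connected induced subgraphs of the squared path\<close>

text \<open>The element \<open>y\<close> only certifies that \<open>x\<close> is not the maximum of
  \<open>T\<close>. Gaps are thus bounded without enumerating \<open>T\<close> in increasing
  order.\<close>

definition linked :: "nat set \<Rightarrow> bool" where
  "linked T \<longleftrightarrow> (\<forall>x\<in>T. \<forall>y\<in>T. x < y \<longrightarrow> x + 1 \<in> T \<or> x + 2 \<in> T)"

text \<open>\<open>connected\<close> means strong connectivity of the symmetric closure. The arc set
  is symmetric already, so taking the closure adds nothing and reachability can be studied in an
  explicit relation.\<close>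

lemma parcs_mk_symmetric_squared_path_restrict:
  assumes "T \<subseteq> {1..n}"
  shows "parcs (mk_symmetric (with_proj (squared_path n) \<restriction> T)) =
    {(x, y). x \<in> T \<and> y \<in> T \<and> (y = x + 1 \<or> y = x + 2 \<or> x = y + 1 \<or> x = y + 2)}"
  (is "?L = ?R")
proof -
  have "(x, y) \<in> parcs (squared_path n) \<longleftrightarrow>
      x \<in> {1..n} \<and> y \<in> {1..n} \<and> (y = x + 1 \<or> y = x + 2 \<or> x = y + 1 \<or> x = y + 2)" for x y
  proof -
    have "(x, y) \<in> parcs (squared_path n) \<longleftrightarrow>
        (1 \<le> x \<and> x + 1 \<le> n \<and> y = x + 1) \<or> (1 \<le> y \<and> y + 1 \<le> n \<and> x = y + 1) \<or>
        (1 \<le> x \<and> x + 2 \<le> n \<and> y = x + 2) \<or> (1 \<le> y \<and> y + 2 \<le> n \<and> x = y + 2)"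
      unfolding squared_path_def by auto
    also have "\<dots> \<longleftrightarrow> 1 \<le> x \<and> x \<le> n \<and> 1 \<le> y \<and> y \<le> n \<and>
        (y = x + 1 \<or> y = x + 2 \<or> x = y + 1 \<or> x = y + 2)"
      by (intro iffI; elim disjE conjE; simp)
    finally show ?thesis by simp
  qed
  then have "(x, y) \<in> arcs (with_proj (squared_path n) \<restriction> T) \<longleftrightarrow> (x, y) \<in> ?R" for x y
    using subsetD[OF assms, of x] subsetD[OF assms, of y] by auto
  then have arcs: "arcs (with_proj (squared_path n) \<restriction> T) = ?R"
    by (intro set_eqI) (simp only: split_paired_all)
  have sym_Un: "(\<Union>e\<in>R. {(fst e, snd e), (snd e, fst e)}) = R" if "sym R" for R :: "'b rel"
    using that by (auto simp: sym_def)
  have "?L = (\<Union>e\<in>?R. {(fst e, snd e), (snd e, fst e)})"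
    unfolding parcs_mk_symmetric arcs by simp
  also have "\<dots> = ?R"
    by (rule sym_Un) (auto simp: sym_def)
  finally show ?thesis .
qed

text \<open>A walk cannot cross a gap of 3 or more, and without such gaps one can climb from any
  vertex to any larger one. The empty set is excluded because it is linked, while the empty digraph
  is not connected.\<close>

lemma connected_squared_path_iff_linked:
  assumes T: "T \<subseteq> {1..n}" "T \<noteq> {}"
  shows "connected (with_proj (squared_path n) \<restriction> T) \<longleftrightarrow> linked T"
proof -
  let ?E = "{(x, y). x \<in> T \<and> y \<in> T \<and> (y = x + 1 \<or> y = x + 2 \<or> x = y + 1 \<or> x = y + 2)}"
  have conn: "connected (with_proj (squared_path n) \<restriction> T) \<longleftrightarrow>
      (\<forall>u\<in>T. \<forall>v\<in>T. (u, v) \<in> rtrancl_on T ?E)"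
    using T(2) parcs_mk_symmetric_squared_path_restrict[OF T(1)]
    unfolding connected_def strongly_connected_def reachable_def by simp
  show ?thesis
  proof
    assume c: "connected (with_proj (squared_path n) \<restriction> T)"
    show "linked T"
      unfolding linked_def
    proof (intro ballI impI, rule ccontr)
      fix x y assume xy: "x \<in> T" "y \<in> T" "x < y" and gap: "\<not> (x + 1 \<in> T \<or> x + 2 \<in> T)"
      have "(x, y) \<in> rtrancl_on T ?E" using c xy conn by blast
      \<comment> \<open>Invariant: a walk from \<open>x\<close> never rises above \<open>x\<close>.
        An arc climbs by at most 2, and both \<open>x + 1\<close> and \<open>x + 2\<close> are
        missing.\<close>
      then have "y \<le> x"
      proof (induction rule: rtrancl_on_induct)
        case (step u v)
        from step.hyps have v: "v \<in> T" "v \<le> u + 2" by auto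
        show ?case
        proof (rule ccontr)
          assume "\<not> v \<le> x"
          with v step.IH have "v = x + 1 \<or> v = x + 2" by linarith
          with v gap show False by blast
        qed
      qed simp
      with xy show False by simp
    qed
  next
    assume l: "linked T"
    have up: "(x, y) \<in> rtrancl_on T ?E" if "x \<in> T" "y \<in> T" "x \<le> y" for x y
      using that
    proof (induction "y - x" arbitrary: x rule: less_induct)
      case less
      show ?case
      proof (cases "x = y")
        case True
        with less.prems show ?thesis by auto
      next
        case False
        then have "x < y" using less.prems by simp
        with l less.prems have "x + 1 \<in> T \<or> x + 2 \<in> T" unfolding linked_def by blast
        then obtain z where z: "z \<in> T" "z = x + 1 \<or> z = x + 2" "z \<le> y \<or> x + 1 = y"
          using \<open>x < y\<close> by force
        \<comment> \<open>The choice \<open>z = x + 2\<close> overshoots when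
          \<open>y = x + 1\<close>; in that case the walk steps to \<open>y\<close>
          directly.\<close>
        define w where "w = (if x + 1 = y then y else z)"
        have w: "w \<in> T" "w = x + 1 \<or> w = x + 2" "w \<le> y"
          using z less.prems unfolding w_def by auto
        have "(w, y) \<in> rtrancl_on T ?E" using less.hyps[of w] w less.prems \<open>x < y\<close> by auto
        moreover have "(x, w) \<in> ?E" using w less.prems by auto
        ultimately show ?thesis
          using less.prems(1) by (meson converse_rtrancl_on_into_rtrancl_on)
      qed
    qed
    have "sym ?E" by (auto simp: sym_def)
    then have "sym (rtrancl_on T ?E)" by (rule rtrancl_on_sym)
    then have "(x, y) \<in> rtrancl_on T ?E" if "x \<in> T" "y \<in> T" for x y
      using up[OF that] symD[OF _ up[OF that(2,1)]] by (cases "x \<le> y") simp_all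
    then show "connected (with_proj (squared_path n) \<restriction> T)"
      unfolding conn by (intro ballI)
  qed
qed

section \<open>Counting the connected sets of size k\<close>

text \<open>The \<open>i\<close> gaps of such a set are 1 or 2 and add up to \<open>i + j\<close>,
  so exactly \<open>j\<close> of them equal 2.\<close>

definition linked_from_to :: "nat \<Rightarrow> nat \<Rightarrow> nat \<Rightarrow> nat set set" where
  "linked_from_to i j m =
    {T. T \<subseteq> {m..m + i + j} \<and> m \<in> T \<and> m + i + j \<in> T \<and> card T = Suc i \<and> linked T}"

lemma finite_linked_from_to: "finite (linked_from_to i j m)"
  by (rule finite_subset[of _ "Pow {m..m + i + j}"]) (auto simp: linked_from_to_def)

lemma linked_insert_below:
  assumes "linked T" and "m + 1 \<in> T \<or> m + 2 \<in> T"
  shows "linked (insert m T)"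
  unfolding linked_def
proof (intro ballI impI)
  fix x y assume xy: "x \<in> insert m T" "y \<in> insert m T" "x < y"
  show "x + 1 \<in> insert m T \<or> x + 2 \<in> insert m T"
  proof (cases "x = m")
    case False
    \<comment> \<open>If \<open>y = m\<close>, then \<open>m + 1\<close> or \<open>m + 2\<close>
      takes over as the element of \<open>T\<close> above \<open>x\<close>.\<close>
    have "\<exists>z\<in>T. x < z"
    proof (cases "y = m")
      case True
      obtain z where "z \<in> T" "m < z" using assms(2) by force
      with True xy(3) show ?thesis using less_trans by blast
    next
      case False
      with xy show ?thesis by blast
    qed
    with False xy(1) assms(1) show ?thesis unfolding linked_def by blast
  qed (use assms(2) in auto)
qed

lemma linked_remove_below:
  assumes "linked T" and "T \<subseteq> {m..}"
  shows "linked (T - {m})"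
  unfolding linked_def
proof (intro ballI impI)
  fix x y assume xy: "x \<in> T - {m}" "y \<in> T - {m}" "x < y"
  then have "m < x" using assms(2) by force
  moreover have "x + 1 \<in> T \<or> x + 2 \<in> T" using xy assms(1) unfolding linked_def by blast
  ultimately show "x + 1 \<in> T - {m} \<or> x + 2 \<in> T - {m}" by auto
qed

text \<open>The sets are sorted by their first gap: a gap of 1 keeps the number \<open>j\<close> of
  gaps equal to 2, and a gap of 2 uses one up. The conditional keeps \<open>j - 1\<close> from being
  truncated.\<close>

lemma linked_from_to_Suc:
  "linked_from_to (Suc i) j m =
    insert m ` linked_from_to i j (m + 1) \<union>
    (if j = 0 then {} else insert m ` linked_from_to i (j - 1) (m + 2))"
  (is "?L = ?A \<union> ?B")
proof
  show "?A \<union> ?B \<subseteq> ?L"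
  proof
    fix T assume "T \<in> ?A \<union> ?B"
    then consider S where "T = insert m S" "S \<in> linked_from_to i j (m + 1)"
      | S where "T = insert m S" "S \<in> linked_from_to i (j - 1) (m + 2)" "j \<noteq> 0"
      by (auto split: if_splits)
    then obtain S where S: "T = insert m S" "S \<subseteq> {m + 1..m + Suc i + j}" "m + Suc i + j \<in> S"
        "card S = Suc i" "linked S" "m + 1 \<in> S \<or> m + 2 \<in> S"
    proof cases
      case 1
      then show ?thesis by (intro that[of S]) (auto simp: linked_from_to_def)
    next
      case 2
      then have "m + 2 + i + (j - 1) = m + Suc i + j" by simp
      with 2 show ?thesis by (intro that[of S]) (auto simp: linked_from_to_def)
    qed
    have "finite S" using S(2) finite_subset by blast
    moreover have "m \<notin> S" using S(2) by auto
    ultimately show "T \<in> ?L"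
      using S linked_insert_below[OF S(5,6)] by (auto simp: linked_from_to_def)
  qed
  show "?L \<subseteq> ?A \<union> ?B"
  proof
    fix T assume "T \<in> ?L"
    then have T: "T \<subseteq> {m..m + Suc i + j}" "m \<in> T" "m + Suc i + j \<in> T" "card T = Suc (Suc i)"
        "linked T"
      by (auto simp: linked_from_to_def)
    define S where "S = T - {m}"
    have fin: "finite T" using T(1) finite_subset by blast
    have "T \<subseteq> {m..}" using T(1) by auto
    then have S: "T = insert m S" "card S = Suc i" "linked S" "m + Suc i + j \<in> S"
      using T fin linked_remove_below[OF T(5)] unfolding S_def by auto
    show "T \<in> ?A \<union> ?B"
    proof (cases "m + 1 \<in> T")
      case True
      then have "S \<in> linked_from_to i j (m + 1)"
        using S T unfolding linked_from_to_def S_def by auto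
      with S show ?thesis by blast
    next
      case False
      have "m < m + Suc i + j" by simp
      then have "m + 2 \<in> T" using T(2,3,5) False unfolding linked_def by blast
      have sub: "S \<subseteq> {m + 2..m + Suc i + j}"
      proof
        fix x assume x: "x \<in> S"
        then have "x \<noteq> m" "x \<noteq> m + 1" "x \<in> {m..m + Suc i + j}"
          using T(1) False unfolding S_def by auto
        then show "x \<in> {m + 2..m + Suc i + j}" by auto
      qed
      \<comment> \<open>This interval has \<open>i + j\<close> elements and must hold the
        \<open>i + 1\<close> elements of \<open>S\<close>.\<close>
      have "card S \<le> card {m + 2..m + Suc i + j}" by (rule card_mono) (use sub in auto)
      then have "j \<noteq> 0" using S(2) by auto
      then have "S \<in> linked_from_to i (j - 1) (m + 2)"
        using S sub \<open>m + 2 \<in> T\<close> unfolding linked_from_to_def S_def by auto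
      with S \<open>j \<noteq> 0\<close> show ?thesis by auto
    qed
  qed
qed

text \<open>The recursion is Pascal's rule: adding \<open>m\<close> below is injective, and
  membership of \<open>m + 1\<close> separates the two families.\<close>

lemma card_linked_from_to: "card (linked_from_to i j m) = i choose j"
proof (induction i arbitrary: j m)
  case 0
  show ?case
  proof (cases "j = 0")
    case True
    have "linked_from_to 0 0 m = {{m}}"
      by (auto simp: linked_from_to_def linked_def)
    with True show ?thesis by simp
  next
    case False
    have "linked_from_to 0 j m = {}"
      using False by (auto simp: linked_from_to_def card_1_singleton_iff)
    with False show ?thesis by simp
  qed
next
  case (Suc i)
  have card_img: "card (insert m ` linked_from_to i j' m') = i choose j'" if "m < m'" for j' m'
  proof -
    have "inj_on (insert m) (linked_from_to i j' m')"
    proof (rule inj_onI)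
      fix A B assume "A \<in> linked_from_to i j' m'" "B \<in> linked_from_to i j' m'"
        and eq: "insert m A = insert m B"
      then have "m \<notin> A" "m \<notin> B" using that by (auto simp: linked_from_to_def)
      with eq show "A = B" by (simp add: insert_ident)
    qed
    with Suc.IH show ?thesis by (simp add: card_image)
  qed
  show ?case
  proof (cases j)
    case 0
    then show ?thesis
      using card_img[of "m + 1" 0] by (simp add: linked_from_to_Suc)
  next
    case (Suc j')
    have "insert m ` linked_from_to i j (m + 1) \<inter> insert m ` linked_from_to i j' (m + 2) = {}"
    proof -
      have "m + 1 \<in> T" if "T \<in> insert m ` linked_from_to i j (m + 1)" for T
        using that by (auto simp: linked_from_to_def)
      moreover have "m + 1 \<notin> T" if "T \<in> insert m ` linked_from_to i j' (m + 2)" for T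
        using that by (auto simp: linked_from_to_def)
      ultimately show ?thesis by blast
    qed
    then have "card (linked_from_to (Suc i) j m) = (i choose j) + (i choose j')"
      using card_img[of "m + 1" j] card_img[of "m + 2" j'] Suc
      by (simp add: linked_from_to_Suc card_Un_disjoint finite_linked_from_to)
    with Suc show ?thesis by simp
  qed
qed

lemma card_linked_subsets:
  assumes "1 \<le> k" "k \<le> n"
  shows "card {T. T \<subseteq> {1..n} \<and> card T = k \<and> linked T} = z_coeff k n"
proof -
  define i where "i = k - 1"
  have k: "k = Suc i" using assms by (simp add: i_def)
  \<comment> \<open>The pairs consist of the number \<open>j\<close> of gaps equal to 2 and the
    minimum \<open>m\<close>. The bound on \<open>m\<close> says that the maximum
    \<open>m + (k - 1) + j\<close> is at most \<open>n\<close>.\<close>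
  let ?I = "SIGMA j:{0..n - k}. {1..n - k - j + 1}"
  have "{T. T \<subseteq> {1..n} \<and> card T = k \<and> linked T} = (\<Union>(j, m)\<in>?I. linked_from_to i j m)"
    (is "?L = ?R")
  proof
    show "?R \<subseteq> ?L"
    proof
      fix T assume "T \<in> ?R"
      then obtain j m where jm: "j \<le> n - k" "1 \<le> m" "m \<le> n - k - j + 1"
        and T: "T \<in> linked_from_to i j m" by auto
      have "m + i + j \<le> n" using jm assms k by linarith
      then have "{m..m + i + j} \<subseteq> {1..n}" using jm(2) by auto
      with T k show "T \<in> ?L" by (auto simp: linked_from_to_def)
    qed
    show "?L \<subseteq> ?R"
    proof
      fix T assume "T \<in> ?L"
      then have T: "T \<subseteq> {1..n}" "card T = Suc i" "linked T" using k by auto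
      have fin: "finite T" using T(1) finite_subset by blast
      have ne: "T \<noteq> {}" using T(2) by auto
      let ?a = "Min T" and ?b = "Max T"
      have a: "?a \<in> T" and b: "?b \<in> T" using fin ne by auto
      have sub: "T \<subseteq> {?a..?b}" using fin by auto
      have "card T \<le> card {?a..?b}" by (rule card_mono) (use sub in auto)
      then have "?a + i \<le> ?b" using T(2) by auto
      define j where "j = ?b - ?a - i"
      have bj: "?b = ?a + i + j" using \<open>?a + i \<le> ?b\<close> by (simp add: j_def)
      have "T \<in> linked_from_to i j ?a"
        using T a b sub bj by (auto simp: linked_from_to_def)
      moreover have "1 \<le> ?a" "?b \<le> n" using a b T(1) by auto
      then have "(j, ?a) \<in> ?I" using bj k by auto
      ultimately show "T \<in> ?R" by blast
    qed
  qed
  also have "card \<dots> = (\<Sum>(j, m)\<in>?I. card (linked_from_to i j m))"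
  proof -
    \<comment> \<open>A set determines \<open>m\<close> as its minimum and then \<open>j\<close>
      from its maximum.\<close>
    have "linked_from_to i j m \<inter> linked_from_to i j' m' = {}" if "(j, m) \<noteq> (j', m')" for j m j' m'
    proof (rule ccontr)
      assume "\<not> ?thesis"
      then obtain T where T: "T \<in> linked_from_to i j m" "T \<in> linked_from_to i j' m'" by auto
      then have "m = m'" "m + i + j = m' + i + j'"
        by (auto simp: linked_from_to_def intro!: antisym)
      with that show False by simp
    qed
    then show ?thesis
      by (subst card_UN_disjoint) (auto simp: finite_linked_from_to split_def)
  qed
  also have "\<dots> = (\<Sum>j = 0..n - k. (i choose j) * (n - k - j + 1))"
    by (subst sum.Sigma[symmetric]) (auto simp: card_linked_from_to mult.commute)
  \<comment> \<open>The binomial coefficient vanishes for \<open>j > i\<close>.\<close>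
  also have "\<dots> = (\<Sum>j = 0..min i (n - k). (i choose j) * (n - k - j + 1))"
    by (rule sum.mono_neutral_right) auto
  also have "\<dots> = z_coeff k n"
    by (simp add: z_coeff_def i_def Let_def)
  finally show ?thesis .
qed

section \<open>Sets all of whose k-subsets are connected\<close>

text \<open>Once \<open>a + 1\<close> and \<open>a + 2\<close> are avoided, the minimum
  \<open>a\<close> is cut off from everything above it. At least \<open>k - 1\<close> other elements
  remain to complete a \<open>k\<close>-set, and \<open>2 \<le> k\<close> ensures that one of them
  is used.\<close>

lemma exists_not_linked_subset:
  assumes "finite W" "2 \<le> k" "k + 2 \<le> card W"
  shows "\<exists>T\<subseteq>W. card T = k \<and> \<not> linked T"
proof -
  have ne: "W \<noteq> {}" using assms by auto
  define a where "a = Min W"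
  have a: "a \<in> W" "\<And>x. x \<in> W \<Longrightarrow> a \<le> x" using assms(1) ne by (auto simp: a_def)
  define U where "U = W - {a, a + 1, a + 2}"
  have "card W - card {a, a + 1, a + 2} \<le> card U"
    unfolding U_def by (rule diff_card_le_card_Diff) simp
  then have "k - 1 \<le> card U" using assms by simp
  then obtain S where S: "S \<subseteq> U" "card S = k - 1" "finite S"
    using obtain_subset_with_card_n by metis
  have aS: "a \<notin> S" "a + 1 \<notin> S" "a + 2 \<notin> S" using S(1) by (auto simp: U_def)
  have "S \<noteq> {}" using S(2) assms(2) by auto
  then obtain y where y: "y \<in> S" by blast
  have "y \<in> W" "y \<noteq> a" using y S(1) by (auto simp: U_def)
  then have "a < y" using a(2)[of y] by simp
  have "\<not> linked (insert a S)"
    unfolding linked_def using aS y \<open>a < y\<close> by fastforce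
  moreover have "card (insert a S) = k" using S aS assms(2) by simp
  moreover have "insert a S \<subseteq> W" using S(1) a(1) by (auto simp: U_def)
  ultimately show ?thesis by blast
qed

text \<open>After a missing \<open>x + 1\<close>, deleting \<open>x + 2\<close> would widen the gap
  unless \<open>x + 2\<close> is the maximum. In that case \<open>x\<close> is deleted instead, and
  the third element guarantees something below \<open>x\<close> to be cut off.\<close>

lemma all_linked_imp_no_gap:
  assumes fin: "finite W" and c: "3 \<le> card W" and all: "\<And>w. w \<in> W \<Longrightarrow> linked (W - {w})"
    and x: "x \<in> W" "x < Max W"
  shows "x + 1 \<in> W"
proof (rule ccontr)
  assume nx: "x + 1 \<notin> W"
  define M where "M = Max W"
  have "W \<noteq> {}" using x(1) by blast
  then have M: "M \<in> W" "\<And>z. z \<in> W \<Longrightarrow> z \<le> M" using fin by (simp_all add: M_def)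
  have "x < M" using x by (simp add: M_def)
  \<comment> \<open>As \<open>w\<close> is not the maximum, \<open>M\<close> survives the deletion
    and certifies that \<open>v\<close> has an element above it.\<close>
  have step: "v + 1 \<in> W - {w} \<or> v + 2 \<in> W - {w}" if "w \<in> W" "v \<in> W - {w}" "w \<noteq> M" "v < M" for v w
    using all[OF that(1)] that M(1) unfolding linked_def by blast
  have "card {x, M} \<le> 2" by (simp add: card_insert_if)
  then have "\<not> W \<subseteq> {x, M}" using c card_mono[of "{x, M}" W] by auto
  then obtain w where w: "w \<in> W" "w \<noteq> x" "w \<noteq> M" by blast
  have "x + 2 \<in> W" using step[of w x] w x(1) \<open>x < M\<close> nx by auto
  moreover have "x + 2 = M"
    using step[of "x + 2" x] x(1) \<open>x < M\<close> nx \<open>x + 2 \<in> W\<close> by auto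
  ultimately have "w < x"
  proof -
    have "w \<le> M" "w \<noteq> x + 1" using w(1) M(2) nx by auto
    with w(2,3) \<open>x + 2 = M\<close> show ?thesis by linarith
  qed
  \<comment> \<open>The predecessor \<open>z\<close> of \<open>x\<close> exists because
    \<open>w < x\<close>. With \<open>x\<close> deleted, \<open>z\<close> would have to reach
    \<open>x + 1\<close> or an element strictly between \<open>z\<close> and
    \<open>x\<close>.\<close>
  let ?B = "{v \<in> W. v < x}"
  define z where "z = Max ?B"
  have finB: "finite ?B" using fin by simp
  have "z \<in> ?B" unfolding z_def by (rule Max_in) (use finB w \<open>w < x\<close> in auto)
  then have z: "z \<in> W" "z < x" by auto
  have zmax: "v \<le> z" if "v \<in> W" "v < x" for v
    unfolding z_def by (rule Max_ge) (use finB that in auto)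
  have "z + 1 \<in> W - {x} \<or> z + 2 \<in> W - {x}"
    using step[of x z] x(1) z \<open>x < M\<close> by auto
  then show False
  proof
    assume "z + 1 \<in> W - {x}"
    with zmax[of "z + 1"] z nx show False by auto
  next
    assume v: "z + 2 \<in> W - {x}"
    then have "\<not> z + 2 < x" using zmax[of "z + 2"] by auto
    with v have "z + 2 > x" by auto
    with z have "z + 2 = x + 1" by simp
    with v nx show False by simp
  qed
qed

lemma card_all_linked_subsets_Suc:
  assumes "2 \<le> k" "k \<le> n"
  shows "card {W. W \<subseteq> {1..n} \<and> card W = Suc k \<and> (\<forall>T\<subseteq>W. card T = k \<longrightarrow> linked T)} = n - k"
proof -
  have "{W. W \<subseteq> {1..n} \<and> card W = Suc k \<and> (\<forall>T\<subseteq>W. card T = k \<longrightarrow> linked T)} =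
      (\<lambda>m. {m..m + k}) ` {1..n - k}" (is "?L = ?R")
  proof
    show "?L \<subseteq> ?R"
    proof
      fix W assume "W \<in> ?L"
      then have W: "W \<subseteq> {1..n}" "card W = Suc k" and all: "\<And>T. T \<subseteq> W \<Longrightarrow> card T = k \<Longrightarrow> linked T"
        by auto
      have fin: "finite W" using W(1) finite_subset by blast
      have ne: "W \<noteq> {}" using W(2) by auto
      let ?a = "Min W" and ?b = "Max W"
      have a: "?a \<in> W" and b: "?b \<in> W" using fin ne by auto
      have up: "x + 1 \<in> W" if "x \<in> W" "x < ?b" for x
      proof (rule all_linked_imp_no_gap[OF fin _ _ that])
        show "3 \<le> card W" using W(2) assms by simp
        show "linked (W - {w})" if "w \<in> W" for w
          using that W(2) fin by (intro all) auto
      qed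
      have "x \<in> W" if "?a \<le> x" "x \<le> ?b" for x
        using that by (induction x rule: dec_induct) (use a up in auto)
      moreover have "W \<subseteq> {?a..?b}" using fin by auto
      ultimately have eq: "W = {?a..?b}" by (intro subset_antisym) (auto simp del: Min_le_iff Max_ge_iff)
      have "card W = Suc ?b - ?a" by (subst eq) simp
      then have "Suc k = Suc ?b - ?a" using W(2) by simp
      then have "?b = ?a + k" by simp
      moreover have "1 \<le> ?a" "?b \<le> n" using a b W(1) by auto
      ultimately show "W \<in> ?R" using eq by auto
    qed
    show "?R \<subseteq> ?L"
    proof
      fix W assume "W \<in> ?R"
      then obtain m where m: "1 \<le> m" "m \<le> n - k" and W: "W = {m..m + k}" by auto
      have "linked T" if T: "T \<subseteq> W" "card T = k" for T
      proof -
        have finT: "finite T" using T(1) W finite_subset by blast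
        have "card (W - T) = 1" using T W finT by (subst card_Diff_subset) auto
        then obtain w where w: "W - T = {w}" by (auto simp: card_1_singleton_iff)
        show ?thesis
          unfolding linked_def
        proof (intro ballI impI)
          fix x y assume xy: "x \<in> T" "y \<in> T" "x < y"
          \<comment> \<open>Unless \<open>y\<close> is the next integer, both candidates lie in the
            interval, and only one of them can be the deleted point \<open>w\<close>.\<close>
          have "y = x + 1 \<or> {x + 1, x + 2} \<subseteq> W" using xy T(1) W by auto
          then show "x + 1 \<in> T \<or> x + 2 \<in> T"
          proof
            assume "{x + 1, x + 2} \<subseteq> W"
            with w have "x + 1 \<in> T \<or> x + 1 = w" "x + 2 \<in> T \<or> x + 2 = w" by blast+
            then show ?thesis by force
          qed (use xy in simp)
        qed
      qed
      with m W assms show "W \<in> ?L" by auto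
    qed
  qed
  also have "card \<dots> = n - k"
    by (subst card_image) (auto simp: inj_on_def Icc_eq_Icc)
  finally show ?thesis .
qed

section \<open>Faces and the complements of non-faces\<close>

text \<open>A set avoids \<open>T\<close> iff its complement contains \<open>T\<close>. The
  assumption \<open>1 \<le> k\<close> makes every relevant \<open>T\<close> nonempty, as the
  connectivity criterion requires.\<close>

lemma cut_complex_squared_path:
  assumes "1 \<le> k"
  shows "cut_complex k (squared_path n) =
    {F. F \<subseteq> {1..n} \<and> (\<exists>T\<subseteq>{1..n} - F. card T = k \<and> \<not> linked T)}"
proof -
  have "(T \<subseteq> {1..n} \<and> card T = k \<and> \<not> connected (with_proj (squared_path n) \<restriction> T)) \<longleftrightarrow>
      (T \<subseteq> {1..n} \<and> card T = k \<and> \<not> linked T)" for T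
    using connected_squared_path_iff_linked[of T n] assms by (cases "T = {}") auto
  then have facets: "cut_complex_facets k (squared_path n) =
      {{1..n} - T | T. T \<subseteq> {1..n} \<and> card T = k \<and> \<not> linked T}"
    unfolding cut_complex_facets_def by (simp add: squared_path_def)
  have "(\<exists>S\<in>{V - T | T. T \<subseteq> V \<and> card T = k \<and> \<not> linked T}. F \<subseteq> S) \<longleftrightarrow>
      F \<subseteq> V \<and> (\<exists>T\<subseteq>V - F. card T = k \<and> \<not> linked T)" for F V
  proof -
    have "T \<subseteq> V \<and> F \<subseteq> V - T \<longleftrightarrow> F \<subseteq> V \<and> T \<subseteq> V - F" for T by blast
    moreover have "(\<exists>S\<in>{V - T | T. T \<subseteq> V \<and> card T = k \<and> \<not> linked T}. F \<subseteq> S) \<longleftrightarrow>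
        (\<exists>T. card T = k \<and> \<not> linked T \<and> T \<subseteq> V \<and> F \<subseteq> V - T)"
      by blast
    ultimately show ?thesis by auto
  qed
  then show ?thesis
    unfolding cut_complex_def facets by simp
qed

text \<open>Complementation matches the non-faces of size \<open>p\<close> (\<open>?B\<close> in the
  proof) with the sets in the second term. The additive form avoids truncated subtraction.\<close>

lemma card_faces_add_card_all_linked:
  assumes "1 \<le> k" "p \<le> n"
  shows "card {F \<in> cut_complex k (squared_path n). card F = p} +
    card {W. W \<subseteq> {1..n} \<and> card W = n - p \<and> (\<forall>T\<subseteq>W. card T = k \<longrightarrow> linked T)} = n choose p"
proof -
  let ?V = "{1..n}"
  let ?A = "{F \<in> cut_complex k (squared_path n). card F = p}"
  let ?W = "{W. W \<subseteq> ?V \<and> card W = n - p \<and> (\<forall>T\<subseteq>W. card T = k \<longrightarrow> linked T)}"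
  let ?B = "{F. F \<subseteq> ?V \<and> card F = p \<and> (\<forall>T\<subseteq>?V - F. card T = k \<longrightarrow> linked T)}"
  have compl: "card (?V - F) = n - card F" if "F \<subseteq> ?V" for F
    using that by (subst card_Diff_subset) (auto intro: finite_subset)
  have dd: "?V - (?V - F) = F" if "F \<subseteq> ?V" for F using that by blast
  have "bij_betw (\<lambda>F. ?V - F) ?B ?W"
  proof (rule bij_betw_byWitness[where f' = "\<lambda>F. ?V - F"])
    show "(\<lambda>F. ?V - F) ` ?B \<subseteq> ?W" using compl by blast
    show "(\<lambda>F. ?V - F) ` ?W \<subseteq> ?B"
    proof (rule image_subsetI)
      fix W assume "W \<in> ?W"
      then show "?V - W \<in> ?B" using assms(2) compl[of W] dd[of W] by simp
    qed
  qed (use dd in blast)+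
  then have "card ?B = card ?W" by (rule bij_betw_same_card)
  moreover have "card (?A \<union> ?B) = card ?A + card ?B"
    by (rule card_Un_disjoint)
       (auto simp: cut_complex_squared_path[OF assms(1)] intro: finite_subset[of _ "Pow ?V"])
  moreover have "?A \<union> ?B = {F. F \<subseteq> ?V \<and> card F = p}"
    by (auto simp: cut_complex_squared_path[OF assms(1)])
  moreover have "card {F. F \<subseteq> ?V \<and> card F = p} = n choose p"
    by (simp add: n_subsets)
  ultimately show ?thesis by simp
qed

section \<open>Assembling the face polynomial\<close>

lemma face_poly_eq_sum_card:
  assumes "finite \<Delta>" "\<And>F. F \<in> \<Delta> \<Longrightarrow> card F \<le> r"
  shows "face_poly \<Delta> = (\<Sum>p = 0..r. monom (int (card {F \<in> \<Delta>. card F = p})) p)"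
proof -
  have "face_poly \<Delta> = (\<Sum>p = 0..r. \<Sum>F\<in>{F \<in> \<Delta>. card F = p}. monom 1 (card F))"
    unfolding face_poly_def by (rule sum.group[symmetric]) (use assms in auto)
  moreover have "(\<Sum>F\<in>{F \<in> \<Delta>. card F = p}. monom (1::int) (card F)) =
      monom (int (card {F \<in> \<Delta>. card F = p})) p" for p
    by (simp add: of_nat_monom mult_monom)
  ultimately show ?thesis by simp
qed

theorem theorem4p1:
  fixes k n r :: nat
  assumes "2 \<le> k" and "k \<le> n - 2" and "r = n - k"
  shows "face_poly (cut_complex k (squared_path n)) =
           (\<Sum>p = 0..r. monom (int (n choose p)) p)
             - monom (int r) (r - 1) - monom (int (z_coeff k n)) r
       \<and> (\<forall>p \<le> r - 2. card {F \<in> cut_complex k (squared_path n). card F = p} = n choose p)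
       \<and> int (card {F \<in> cut_complex k (squared_path n). card F = r - 1}) =
           int (n choose (r - 1)) - int r
       \<and> int (card {F \<in> cut_complex k (squared_path n). card F = r}) =
           int (n choose r) - int (z_coeff k n)
       \<and> (\<forall>F \<in> cut_complex k (squared_path n). card F \<le> r)"
proof -
  let ?D = "cut_complex k (squared_path n)"
  let ?f = "\<lambda>p. card {F \<in> ?D. card F = p}"
  let ?N = "\<lambda>p. {W. W \<subseteq> {1..n} \<and> card W = n - p \<and> (\<forall>T\<subseteq>W. card T = k \<longrightarrow> linked T)}"
  \<comment> \<open>The assumptions force \<open>n \<ge> k + 2\<close>, hence
    \<open>r \<ge> 2\<close>. Writing \<open>r\<close> as \<open>Suc (Suc q)\<close> removes the
    subtractions in \<open>r - 1\<close> and \<open>r - 2\<close>.\<close>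
  define q where "q = r - 2"
  have r: "r = Suc (Suc q)" and n: "n = k + r" using assms by (auto simp: q_def)
  have k1: "1 \<le> k" using assms(1) by simp
  note D = cut_complex_squared_path[OF k1, of n]
  have count: "?f p + card (?N p) = n choose p" if "p \<le> r" for p
    using card_faces_add_card_all_linked[OF k1] that n by simp
  have low: "?f p = n choose p" if "p \<le> q" for p
  proof -
    \<comment> \<open>For \<open>p \<le> r - 2\<close> the complements have at least
      \<open>k + 2\<close> elements.\<close>
    have "?N p = {}"
    proof (intro equals0I, clarify)
      fix W :: "nat set"
      assume W: "W \<subseteq> {1..n}" "card W = n - p" "\<forall>T\<subseteq>W. card T = k \<longrightarrow> linked T"
      have "finite W" using W(1) finite_subset by blast
      moreover have "k + 2 \<le> card W" using W(2) that r n by simp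
      ultimately show False using exists_not_linked_subset[OF _ assms(1)] W(3) by blast
    qed
    with count[of p] that r show ?thesis by (simp del: Collect_empty_eq)
  qed
  have mid: "int (?f (Suc q)) = int (n choose Suc q) - int r"
  proof -
    have "n - Suc q = Suc k" using n r by simp
    then have "card (?N (Suc q)) = r"
      using card_all_linked_subsets_Suc[OF assms(1), of n] n by simp
    with count[of "Suc q"] r show ?thesis by linarith
  qed
  have top: "int (?f r) = int (n choose r) - int (z_coeff k n)"
  proof -
    \<comment> \<open>Here the complements have exactly \<open>k\<close> elements, so the only
      \<open>k\<close>-subset of \<open>W\<close> is \<open>W\<close> itself.\<close>
    have "(\<forall>T\<subseteq>W. card T = k \<longrightarrow> linked T) \<longleftrightarrow> linked W"
      if "W \<subseteq> {1..n}" "card W = k" for W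
      using that card_subset_eq[of W] finite_subset[OF that(1)] by auto
    then have "?N r = {T. T \<subseteq> {1..n} \<and> card T = k \<and> linked T}"
      using n by auto
    then have "card (?N r) = z_coeff k n"
      using card_linked_subsets[OF k1, of n] n by simp
    with count[of r] show ?thesis by linarith
  qed
  have bound: "card F \<le> r" if "F \<in> ?D" for F
  proof -
    from that obtain T where F: "F \<subseteq> {1..n}" and T: "T \<subseteq> {1..n} - F" "card T = k"
      unfolding D by blast
    have "card T \<le> card ({1..n} - F)" by (rule card_mono) (use T in auto)
    also have "\<dots> = n - card F"
      using F by (subst card_Diff_subset) (auto intro: finite_subset)
    \<comment> \<open>Since \<open>k\<close> is positive, \<open>k \<le> n - card F\<close> excludes
      truncation and gives \<open>card F \<le> n - k\<close>.\<close>
    finally show ?thesis using T(2) k1 n by linarith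
  qed
  have "finite ?D" unfolding D by (rule finite_subset[of _ "Pow {1..n}"]) auto
  then have "face_poly ?D = (\<Sum>p = 0..r. monom (int (?f p)) p)"
    using bound by (rule face_poly_eq_sum_card)
  also have "\<dots> = (\<Sum>p = 0..q. monom (int (?f p)) p) + monom (int (?f (Suc q))) (Suc q)
      + monom (int (?f r)) r"
    by (simp add: r)
  also have "(\<Sum>p = 0..q. monom (int (?f p)) p) = (\<Sum>p = 0..q. monom (int (n choose p)) p)"
    by (rule sum.cong) (use low in auto)
  also have "\<dots> + monom (int (?f (Suc q))) (Suc q) + monom (int (?f r)) r =
      (\<Sum>p = 0..r. monom (int (n choose p)) p) - monom (int r) (r - 1) - monom (int (z_coeff k n)) r"
    unfolding mid top by (simp add: r diff_monom[symmetric])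
  finally show ?thesis
    using low mid top bound by (simp add: r)
qed

end
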